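(* Let $q$ be an odd prime power and $d\ge0$. Let $(\mathbb F_q^{2d},\omega)$ be a symplectic space and let $(\mathbb F_q^{2d+1},Q)$ be a non-degenerate quadratic space of dimension $2d+1$ admitting a $d$-dimensional totally isotropic subspace. Then $$\sum_{F\in\mathcal{WF}(\mathbb F_q^{2d},\omega)}t^{w(F)}=\sum_{F\in\mathcal{WF}(\mathbb F_q^{2d+1},Q)}t^{w(F)}.$$
   Context: For a space $V$ with a non-degenerate symmetric or alternating bilinear form, a subspace is isotropic if the form vanishes identically on it (for the quadratic space, with respect to the associated symmetric bilinear form, equivalently $Q$ vanishes on it since the characteristic is odd). A flag of such a space is a strictly increasing sequence $V_1\subset\dots\subset V_k$ ($k\ge0$) of nonzero isotropic subspaces; a weighted flag additionally carries strictly positive integers $w_1,\dots,w_k$, with weight $w(F)=\sum_i w_i\dim V_i$. $\mathcal{WF}(\cdot)$ denotes the set of weighted flags. *)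

theory Defs
  imports "HOL-Analysis.Analysis" "HOL-Number_Theory.Prime_Powers"
begin

text \<open>
  A vector space over a field \<open>'k\<close> is given by its scalar multiplication \<open>s\<close> on a type \<open>'v\<close>
  (locale \<open>vector_space\<close>).
\<close>

definition bilinear_form ::
    "('k::field \<Rightarrow> 'v::ab_group_add \<Rightarrow> 'v) \<Rightarrow> ('v \<Rightarrow> 'v \<Rightarrow> 'k) \<Rightarrow> bool" where
  "bilinear_form s B \<longleftrightarrow>
     (\<forall>x. Vector_Spaces.linear s (*) (\<lambda>y. B x y)) \<and>
     (\<forall>y. Vector_Spaces.linear s (*) (\<lambda>x. B x y))"

text \<open>
  Only the left radical is required to vanish; for alternating and for symmetric forms it
  coincides with the right radical.
\<close>

definition nondegenerate :: "('v::ab_group_add \<Rightarrow> 'v \<Rightarrow> 'k::field) \<Rightarrow> bool" where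
  "nondegenerate B \<longleftrightarrow> (\<forall>x. (\<forall>y. B x y = 0) \<longrightarrow> x = 0)"

definition symplectic_form ::
    "('k::field \<Rightarrow> 'v::ab_group_add \<Rightarrow> 'v) \<Rightarrow> ('v \<Rightarrow> 'v \<Rightarrow> 'k) \<Rightarrow> bool" where
  "symplectic_form s \<omega> \<longleftrightarrow> bilinear_form s \<omega> \<and> (\<forall>x. \<omega> x x = 0) \<and> nondegenerate \<omega>"

text \<open>
  The symmetric bilinear form associated with a quadratic form is taken without the factor
  \<open>1/2\<close>, so that \<open>polar Q x x = 2 * Q x\<close>. In odd characteristic the factor changes neither
  non-degeneracy nor the isotropic subspaces.
\<close>

definition polar :: "('v::ab_group_add \<Rightarrow> 'k::field) \<Rightarrow> 'v \<Rightarrow> 'v \<Rightarrow> 'k" where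
  "polar Q x y = Q (x + y) - Q x - Q y"

definition quadratic_form ::
    "('k::field \<Rightarrow> 'v::ab_group_add \<Rightarrow> 'v) \<Rightarrow> ('v \<Rightarrow> 'k) \<Rightarrow> bool" where
  "quadratic_form s Q \<longleftrightarrow> (\<forall>c x. Q (s c x) = c\<^sup>2 * Q x) \<and> bilinear_form s (polar Q)"

definition isotropic ::
    "('k::field \<Rightarrow> 'v::ab_group_add \<Rightarrow> 'v) \<Rightarrow> ('v \<Rightarrow> 'v \<Rightarrow> 'k) \<Rightarrow> 'v set \<Rightarrow> bool" where
  "isotropic s B U \<longleftrightarrow> module.subspace s U \<and> (\<forall>x\<in>U. \<forall>y\<in>U. B x y = 0)"

text \<open>
  The weighted flag \<open>V\<^sub>1 \<subset> \<dots> \<subset> V\<^sub>k\<close> with weights \<open>w\<^sub>1, \<dots>, w\<^sub>k\<close> is the list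
  \<open>[(V\<^sub>1, w\<^sub>1), \<dots>, (V\<^sub>k, w\<^sub>k)]\<close>; the case \<open>k = 0\<close> is the empty list.
\<close>

definition weighted_flags ::
    "('k::field \<Rightarrow> 'v::ab_group_add \<Rightarrow> 'v) \<Rightarrow> ('v \<Rightarrow> 'v \<Rightarrow> 'k) \<Rightarrow> ('v set \<times> nat) list set" where
  "weighted_flags s B =
     {F. sorted_wrt (\<subset>) (map fst F) \<and>
         (\<forall>(V, w)\<in>set F. isotropic s B V \<and> V \<noteq> {0} \<and> w > 0)}"

definition flag_weight ::
    "('k::field \<Rightarrow> 'v::ab_group_add \<Rightarrow> 'v) \<Rightarrow> ('v set \<times> nat) list \<Rightarrow> nat" where
  "flag_weight s F = (\<Sum>(V, w)\<leftarrow>F. w * vector_space.dim s V)"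

text \<open>
  The sum of \<open>t ^ w(F)\<close> over all weighted flags, as an infinite sum of formal power series
  in \<open>t\<close>. The lemma \<open>has_sum_weighted_flags\<close> below shows that it converges.
\<close>

definition weighted_flag_series ::
    "('k::field \<Rightarrow> 'v::ab_group_add \<Rightarrow> 'v) \<Rightarrow> ('v \<Rightarrow> 'v \<Rightarrow> 'k) \<Rightarrow> int fps" where
  "weighted_flag_series s B = (\<Sum>\<^sub>\<infinity>F\<in>weighted_flags s B. fps_X ^ flag_weight s F)"

lemma dim_isotropic_pos:
  fixes s :: "'k::field \<Rightarrow> 'v::{ab_group_add, finite} \<Rightarrow> 'v"
  assumes "vector_space s" "isotropic s B V" "V \<noteq> {0}"
  shows "vector_space.dim s V > 0"
proof -
  interpret vector_space s by fact
  have sub: "subspace V"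
    using assms by (simp add: isotropic_def)
  obtain A where A: "A \<subseteq> V" "independent A" "V \<subseteq> span A" "card A = dim V"
    using basis_exists by blast
  have "A \<noteq> {}"
    using A(3) assms(3) subspace_0[OF sub] by auto
  then show ?thesis
    using A(4) by (metis card_gt_0_iff finite)
qed

lemma finite_weighted_flags_weight:
  fixes s :: "'k::field \<Rightarrow> 'v::{ab_group_add, finite} \<Rightarrow> 'v"
  assumes "vector_space s"
  shows "finite {F \<in> weighted_flags s B. flag_weight s F = n}"
proof -
  have bound: "length F \<le> flag_weight s F \<and> (\<forall>(V, w)\<in>set F. w \<le> flag_weight s F)"
    if "\<forall>(V, w)\<in>set F. isotropic s B V \<and> V \<noteq> {0} \<and> w > 0" for F
    using that
  proof (induction F)
    case Nil
    then show ?case by simp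
  next
    case (Cons a F)
    obtain V w where a: "a = (V, w)" by (cases a)
    have IH: "length F \<le> flag_weight s F" "\<forall>(V, w)\<in>set F. w \<le> flag_weight s F"
      using Cons by auto
    have "isotropic s B V" "V \<noteq> {0}" "w > 0"
      using Cons.prems a by simp_all
    then have "vector_space.dim s V > 0"
      using dim_isotropic_pos[OF assms] by blast
    then have "w \<le> w * vector_space.dim s V" by simp
    moreover have "flag_weight s (a # F) = w * vector_space.dim s V + flag_weight s F"
      by (simp add: flag_weight_def a)
    ultimately have "w + flag_weight s F \<le> flag_weight s (a # F)"
      by linarith
    moreover from this have "w' \<le> flag_weight s (a # F)" if "(V', w') \<in> set F" for V' w'
      using IH(2) that by (auto dest!: bspec[where x = "(V', w')"])
    ultimately show ?case
      using IH(1) \<open>w > 0\<close> by (auto simp: a)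
  qed
  have "{F \<in> weighted_flags s B. flag_weight s F = n} \<subseteq>
          {F. set F \<subseteq> UNIV \<times> {..n} \<and> length F \<le> n}"
  proof safe
    fix F and V :: "'v set" and w
    assume F: "F \<in> weighted_flags s B" and n: "n = flag_weight s F"
    then have b: "length F \<le> flag_weight s F" "\<forall>(V, w)\<in>set F. w \<le> flag_weight s F"
      using bound[of F] by (simp_all add: weighted_flags_def)
    show "length F \<le> flag_weight s F" by (rule b(1))
    show "w \<le> flag_weight s F" if "(V, w) \<in> set F"
      using b(2) that by auto
  qed auto
  moreover have "finite {F. set F \<subseteq> (UNIV :: 'v set set) \<times> {..n} \<and> length F \<le> n}"
    by (intro finite_lists_length_le finite_cartesian_product) auto
  ultimately show ?thesis
    by (rule finite_subset)
qed

lemma has_sum_weighted_flags: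
  fixes s :: "'k::field \<Rightarrow> 'v::{ab_group_add, finite} \<Rightarrow> 'v"
  assumes "vector_space s"
  shows "((\<lambda>F. fps_X ^ flag_weight s F) has_sum weighted_flag_series s B) (weighted_flags s B)"
proof -
  have eq: "{F \<in> weighted_flags s B. fps_nth (fps_X ^ flag_weight s F :: int fps) n \<noteq> 0} =
          {F \<in> weighted_flags s B. flag_weight s F = n}" for n
    by (auto simp: fps_X_power_nth)
  have "((\<lambda>F. fps_X ^ flag_weight s F) has_sum
          Abs_fps (\<lambda>n. int (card {F \<in> weighted_flags s B. flag_weight s F = n})))
        (weighted_flags s B)"
  proof (rule has_sum_fpsI)
    show "finite {F \<in> weighted_flags s B. fps_nth (fps_X ^ flag_weight s F :: int fps) n \<noteq> 0}" for n
      unfolding eq by (rule finite_weighted_flags_weight[OF assms])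
    show "fps_nth (Abs_fps (\<lambda>n. int (card {F \<in> weighted_flags s B. flag_weight s F = n}))) n =
        (\<Sum>F | F \<in> weighted_flags s B \<and> fps_nth (fps_X ^ flag_weight s F :: int fps) n \<noteq> 0.
           fps_nth (fps_X ^ flag_weight s F) n)" for n
      unfolding eq by (simp add: fps_X_power_nth)
  qed
  then show ?thesis
    unfolding weighted_flag_series_def using has_sum_infsum summable_on_def by blast
qed

end

theory Submission
  imports Defs "HOL-Number_Theory.Residues"
begin

text \<open>
  In both spaces an isotropic subspace \<open>U\<close> of dimension \<open>k\<close> can be enlarged by equally many
  vectors: exactly \<open>q ^ (2 * d - k)\<close> vectors of \<open>U\<^sup>\<bottom>\<close> are isotropic. In the symplectic space
  these are all vectors of \<open>U\<^sup>\<bottom>\<close>. In the quadratic space \<open>U\<close> lies in an isotropic \<open>N\<close> of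
  dimension \<open>d\<close>, namely \<open>U + (M \<inter> U\<^sup>\<bottom>)\<close> for any \<open>d\<close>-dimensional isotropic \<open>M\<close>; the
  zeros of \<open>Q\<close> make up a \<open>1/q\<close> fraction of \<open>U\<^sup>\<bottom> - N\<^sup>\<bottom>\<close>, because \<open>Q\<close> is affine and
  not constant on each coset of \<open>N\<close> there, and also of \<open>N\<^sup>\<bottom>\<close>, where they form \<open>N\<close> itself.
  Counting the pairs \<open>(x, V)\<close> with \<open>x \<in> V - U\<close> then gives a formula in \<open>q\<close>, \<open>d\<close>, \<open>k\<close>, \<open>m\<close> for the
  number of \<open>m\<close>-dimensional isotropic \<open>V \<supseteq> U\<close>. Hence the two spaces have equally many weighted
  flags with any prescribed dimensions and weights.
\<close>

lemma two_neq_zero_if_odd_CARD: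
  assumes "odd CARD('a::ring_1)"
  shows "(2 :: 'a) \<noteq> 0"
proof
  assume "(2 :: 'a) = 0"
  then have "CHAR('a) dvd 2"
    by (metis of_nat_eq_0_iff_char_dvd of_nat_numeral)
  moreover have "CHAR('a) \<noteq> 1"
    by simp
  ultimately have "CHAR('a) = 2"
    using two_is_prime_nat prime_nat_iff[of 2] by blast
  with CHAR_dvd_CARD[where 'a = 'a] assms show False
    by simp
qed

lemma one_less_CARD: "1 < CARD('a::{zero_neq_one, finite})"
  using card_mono[of UNIV "{0, 1 :: 'a}"] by simp

lemma card_eq_if_uniform_on_translates:
  fixes X N :: "'a::ab_group_add set"
  assumes "finite X" "finite N" "N \<noteq> {}"
    and closed: "\<And>x n. x \<in> X \<Longrightarrow> n \<in> N \<Longrightarrow> x + n \<in> X"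
    and uniform: "\<And>x. x \<in> X \<Longrightarrow> q * card {n \<in> N. x + n \<in> P} = card N"
  shows "q * card (X \<inter> P) = card X"
proof -
  have "card {x \<in> X. x + n \<in> P} = card (X \<inter> P)" if "n \<in> N" for n
  proof -
    have "(\<lambda>x. x + n) ` X = X"
      using closed that \<open>finite X\<close> by (intro endo_inj_surj) auto
    then have "bij_betw (\<lambda>x. x + n) {x \<in> X. x + n \<in> P} (X \<inter> P)"
      by (intro bij_betw_imageI) auto
    then show ?thesis
      by (rule bij_betw_same_card)
  qed
  then have "(\<Sum>x\<in>X. card {n \<in> N. x + n \<in> P}) = (\<Sum>n\<in>N. card (X \<inter> P))"
    using assms by (intro sum_multicount_gen) auto
  then have "card N * (q * card (X \<inter> P)) = (\<Sum>x\<in>X. q * card {n \<in> N. x + n \<in> P})"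
    by (simp flip: sum_distrib_left)
  also have "\<dots> = card N * card X"
    by (simp add: uniform)
  finally show ?thesis
    using assms by simp
qed

lemma bij_betw_if_card_fibres_eq:
  assumes "\<And>c. finite {x \<in> A. f x = c}" "\<And>c. finite {y \<in> B. g y = c}"
    and "\<And>c. card {x \<in> A. f x = c} = card {y \<in> B. g y = c}"
  obtains h where "bij_betw h A B" "\<And>x. x \<in> A \<Longrightarrow> g (h x) = f x"
proof -
  have "\<forall>c. \<exists>h. bij_betw h {x \<in> A. f x = c} {y \<in> B. g y = c}"
    using assms by (blast intro: finite_same_card_bij)
  then obtain H where H: "\<And>c. bij_betw (H c) {x \<in> A. f x = c} {y \<in> B. g y = c}"
    by metis
  have H_mem: "H (f x) x \<in> B" "g (H (f x) x) = f x" if "x \<in> A" for x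
    using bij_betwE[OF H[of "f x"]] that by auto
  have "bij_betw (\<lambda>x. H (f x) x) A B"
  proof (rule bij_betw_imageI)
    show "inj_on (\<lambda>x. H (f x) x) A"
    proof (rule inj_onI)
      fix x y assume "x \<in> A" "y \<in> A" "H (f x) x = H (f y) y"
      moreover from this have "f x = f y"
        using H_mem(2) by metis
      ultimately show "x = y"
        using inj_onD[OF bij_betw_imp_inj_on[OF H[of "f x"]], of x y] by simp
    qed
    have "y \<in> (\<lambda>x. H (f x) x) ` A" if "y \<in> B" for y
    proof -
      have "y \<in> H (g y) ` {x \<in> A. f x = g y}"
        using bij_betw_imp_surj_on[OF H[of "g y"]] that by simp
      then show ?thesis by (force simp: image_iff)
    qed
    with H_mem(1) show "(\<lambda>x. H (f x) x) ` A = B"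
      by auto
  qed
  then show thesis
    using H_mem(2) by (rule that)
qed

section \<open>Finite vector spaces\<close>

locale finite_vector_space = vector_space s
  for s :: "'k::{field, finite} \<Rightarrow> 'v::{ab_group_add, finite} \<Rightarrow> 'v"
begin

sublocale finite_dimensional_vector_space s "extend_basis {}"
  by unfold_locales
     (simp_all add: independent_extend_basis[OF independent_empty]
       span_extend_basis[OF independent_empty])

declare dim_UNIV [simp del]

lemma card_span_insert:
  assumes "a \<notin> span S"
  shows "card (span (insert a S)) = CARD('k) * card (span S)"
proof -
  let ?combine = "\<lambda>(c, y). s c a + y"
  have "inj_on ?combine (UNIV \<times> span S)"
  proof (rule inj_onI, clarify)
    fix c y c' y'
    assume y: "y \<in> span S" "y' \<in> span S" and eq: "s c a + y = s c' a + y'"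
    have "s (c - c') a = y' - y"
      using eq by (simp add: scale_left_diff_distrib algebra_simps)
    then have "s (c - c') a \<in> span S"
      using y by (simp add: span_diff)
    then have "c = c'"
      using assms span_scale[of "s (c - c') a" S "inverse (c - c')"] by (cases "c = c'") auto
    with eq show "c = c' \<and> y = y'"
      by simp
  qed
  moreover have "?combine ` (UNIV \<times> span S) = span (insert a S)"
  proof (intro equalityI subsetI)
    fix x assume "x \<in> span (insert a S)"
    then obtain k where "x - s k a \<in> span S"
      by (auto simp: span_insert)
    then show "x \<in> ?combine ` (UNIV \<times> span S)"
      by (intro image_eqI[of _ _ "(k, x - s k a)"]) auto
  next
    fix x assume "x \<in> ?combine ` (UNIV \<times> span S)"
    then obtain c y where "x = s c a + y" "y \<in> span S"
      by auto
    then have "x - s c a \<in> span S"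
      by simp
    then show "x \<in> span (insert a S)"
      by (auto simp: span_insert)
  qed
  ultimately show ?thesis
    by (metis card_image card_cartesian_product)
qed

lemma dim_span_insert:
  assumes "subspace U" "x \<notin> U"
  shows "dim (span (insert x U)) = Suc (dim U)"
proof -
  have "span U = U"
    using assms(1) by simp
  with assms(2) show ?thesis
    by (simp only: dim_span dim_insert if_False Suc_eq_plus1)
qed

lemma card_subspace:
  assumes "subspace U"
  shows "card U = CARD('k) ^ dim U"
proof -
  have card_span: "card (span S) = CARD('k) ^ card S" if "independent S" for S
    using finite[of S] that
  proof (induction S rule: finite_induct)
    case (insert a S)
    then show ?case
      by (simp add: independent_insert card_span_insert)
  qed simp
  obtain A where A: "A \<subseteq> U" "independent A" "U \<subseteq> span A" "card A = dim U"
    using basis_exists by blast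
  then have "span A = U"
    using assms by (intro span_subspace)
  with card_span[OF A(2)] A(4) show ?thesis
    by simp
qed

lemma card_functional_level_set:
  assumes "Vector_Spaces.linear s (*) f" "subspace U" "a \<in> U" "f a \<noteq> 0"
  shows "CARD('k) * card {u \<in> U. f u = c} = card U"
proof -
  interpret f: Vector_Spaces.linear s "(*)" f by fact
  have level_sets: "card {u \<in> U. f u = c'} = card {u \<in> U. f u = c}" for c'
  proof (rule bij_betw_same_card)
    define t where "t = s ((c - c') / f a) a"
    have "t \<in> U" "f t = c - c'"
      using assms by (auto simp: t_def f.scale subspace_scale)
    then show "bij_betw (\<lambda>u. u + t) {u \<in> U. f u = c'} {u \<in> U. f u = c}"
      using \<open>subspace U\<close>
      by (intro bij_betw_byWitness[where f' = "\<lambda>u. u - t"])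
         (auto simp: f.add f.diff subspace_add subspace_diff)
  qed
  have "card U = (\<Sum>c'\<in>UNIV. card {u \<in> U. f u = c'})"
    using sum.group[of U UNIV f "\<lambda>_. 1 :: nat"] by simp
  also have "\<dots> = (\<Sum>c'\<in>(UNIV :: 'k set). card {u \<in> U. f u = c})"
    by (intro sum.cong refl level_sets)
  finally show ?thesis
    by simp
qed

end

section \<open>Reflexive forms\<close>

locale finite_reflexive_space = finite_vector_space s
  for s :: "'k::{field, finite} \<Rightarrow> 'v::{ab_group_add, finite} \<Rightarrow> 'v" +
  fixes B :: "'v \<Rightarrow> 'v \<Rightarrow> 'k"
  assumes bilinear: "bilinear_form s B"
    and reflexive: "B x y = 0 \<Longrightarrow> B y x = 0"
begin

lemma linear_form: "Vector_Spaces.linear s (*) (B x)"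
  using bilinear by (simp add: bilinear_form_def)

lemma form_add_left: "B (x + y) z = B x z + B y z"
  and form_add_right: "B z (x + y) = B z x + B z y"
  and form_scale_right: "B z (s c x) = c * B z x"
  using bilinear by (simp_all add: bilinear_form_def Vector_Spaces.linear_iff)

lemma form_zero_right [simp]: "B z 0 = 0"
  using form_scale_right[of z 0 0] by simp

definition orth :: "'v set \<Rightarrow> 'v set" where
  "orth S = {x. \<forall>y\<in>S. B y x = 0}"

definition isotropic_vectors :: "'v set" where
  "isotropic_vectors = {x. B x x = 0}"

lemma subspace_orth: "subspace (orth S)"
  by (rule subspaceI) (auto simp: orth_def form_add_right form_scale_right)

lemma orth_antimono: "S \<subseteq> T \<Longrightarrow> orth T \<subseteq> orth S"
  by (auto simp: orth_def)

lemma subset_orth_commute: "S \<subseteq> orth T \<longleftrightarrow> T \<subseteq> orth S"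
  by (auto simp: orth_def intro: reflexive)

lemma isotropic_iff: "isotropic s B U \<longleftrightarrow> subspace U \<and> U \<subseteq> orth U"
  by (auto simp: isotropic_def orth_def)

lemma isotropic_imp_subset_isotropic_vectors: "isotropic s B U \<Longrightarrow> U \<subseteq> isotropic_vectors"
  by (auto simp: isotropic_def isotropic_vectors_def)

lemma isotropic_zero: "isotropic s B {0}"
  by (auto simp: isotropic_iff orth_def subspace_def)

lemma isotropic_span:
  assumes "S \<subseteq> orth S"
  shows "isotropic s B (span S)"
proof -
  have "span S \<subseteq> orth S"
    using assms subspace_orth by (rule span_minimal)
  then have "S \<subseteq> orth (span S)"
    by (simp only: subset_orth_commute)
  then have "span S \<subseteq> orth (span S)"
    using subspace_orth by (rule span_minimal)
  then show ?thesis
    by (simp add: isotropic_iff)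
qed

lemma isotropic_span_insert:
  assumes "isotropic s B U" "x \<in> orth U" "x \<in> isotropic_vectors"
  shows "isotropic s B (span (insert x U))"
proof (rule isotropic_span)
  have "U \<subseteq> orth {x}"
    using assms(2) subset_orth_commute[of U "{x}"] by simp
  with assms show "insert x U \<subseteq> orth (insert x U)"
    by (auto simp: isotropic_iff orth_def isotropic_vectors_def)
qed

lemma card_orthogonal_pairs:
  assumes "subspace Y"
  shows "CARD('k) * (\<Sum>x\<in>X. card {y \<in> Y. B x y = 0}) =
    card X * card Y + (CARD('k) - 1) * (card (X \<inter> orth Y) * card Y)"
proof -
  have "CARD('k) * card {y \<in> Y. B x y = 0} =
      card Y + (if x \<in> orth Y then (CARD('k) - 1) * card Y else 0)" for x
  proof (cases "x \<in> orth Y")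
    case True
    then have "{y \<in> Y. B x y = 0} = Y"
      by (auto simp: orth_def intro: reflexive)
    with True show ?thesis
      by (cases "CARD('k)") auto
  next
    case False
    then obtain a where "a \<in> Y" "B x a \<noteq> 0"
      by (auto simp: orth_def dest: reflexive)
    with False show ?thesis
      by (simp add: card_functional_level_set[OF linear_form assms \<open>a \<in> Y\<close> \<open>B x a \<noteq> 0\<close>])
  qed
  then show ?thesis
    by (simp add: sum_distrib_left sum.distrib flip: sum.inter_restrict)
qed

text \<open>Count the pairs \<open>(x, y) \<in> X \<times> Y\<close> with \<open>B x y = 0\<close> in two ways.\<close>

lemma dim_inter_orth:
  assumes "subspace X" "subspace Y"
  shows "dim (X \<inter> orth Y) + dim Y = dim X + dim (Y \<inter> orth X)"
proof -
  have "{x \<in> X. B x y = 0} = {x \<in> X. B y x = 0}" for y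
    by (auto intro: reflexive)
  then have swap: "(\<Sum>x\<in>X. card {y \<in> Y. B x y = 0}) = (\<Sum>y\<in>Y. card {x \<in> X. B y x = 0})"
    by (intro sum_multicount_gen) auto
  have "(CARD('k) - 1) * (card (X \<inter> orth Y) * card Y) =
      (CARD('k) - 1) * (card (Y \<inter> orth X) * card X)"
    using card_orthogonal_pairs[OF assms(2), of X] card_orthogonal_pairs[OF assms(1), of Y]
    unfolding swap mult.commute[of "card Y" "card X"] by linarith
  then have "card (X \<inter> orth Y) * card Y = card (Y \<inter> orth X) * card X"
    using one_less_CARD[where 'a = 'k] by simp
  then have "CARD('k) ^ (dim (X \<inter> orth Y) + dim Y) = CARD('k) ^ (dim X + dim (Y \<inter> orth X))"
    using assms subspace_orth by (simp add: card_subspace subspace_inter power_add mult.commute)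
  then show ?thesis
    using one_less_CARD[where 'a = 'k] by simp
qed

lemma isotropic_subset_isotropic_of_dim:
  assumes M: "isotropic s B M" "orth M \<inter> isotropic_vectors \<subseteq> M" and U: "isotropic s B U"
  obtains N where "isotropic s B N" "U \<subseteq> N" "dim N = dim M"
proof
  define P where "P = M \<inter> orth U"
  have sub: "subspace U" "subspace M" "subspace P"
    using assms by (auto simp: isotropic_iff P_def subspace_orth subspace_inter)
  show "U \<subseteq> span (U \<union> P)"
    by (auto intro: span_base)
  have "P \<subseteq> orth U" "P \<subseteq> orth P" "U \<subseteq> orth U"
    using M(1) U by (auto simp: P_def isotropic_iff orth_def)
  then have "U \<union> P \<subseteq> orth (U \<union> P)"
    using subset_orth_commute[of P U] by (auto simp: orth_def)
  then show "isotropic s B (span (U \<union> P))"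
    by (rule isotropic_span)
  have "U \<inter> P = U \<inter> orth M"
    using M U isotropic_imp_subset_isotropic_vectors[OF U] by (auto simp: P_def isotropic_iff)
  then have "dim (span (U \<union> P)) + dim (U \<inter> orth M) = dim U + dim P"
    using dim_sums_Int[OF sub(1,3)] sub by (simp add: span_Un span_eq_iff[THEN iffD2] del: dim_span)
  then show "dim (span (U \<union> P)) = dim M"
    using dim_inter_orth[OF sub(2,1)] by (simp add: P_def)
qed

lemma dim_orth:
  assumes "nondegenerate B" "subspace U"
  shows "dim (orth U) + dim U = dim (UNIV :: 'v set)"
proof -
  have "orth UNIV = {0}"
    using assms(1) by (auto simp: orth_def nondegenerate_def intro: reflexive)
  then have "dim (U \<inter> orth UNIV) = 0"
    by simp
  with dim_inter_orth[OF subspace_UNIV assms(2)] show ?thesis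
    by simp
qed

lemma dim_isotropic_le:
  assumes "nondegenerate B" "isotropic s B U"
  shows "2 * dim U \<le> dim (UNIV :: 'v set)"
proof -
  have "dim U \<le> dim (orth U)"
    using assms(2) by (intro dim_subset) (simp add: isotropic_iff)
  with dim_orth[OF assms(1), of U] assms(2) show ?thesis
    by (simp add: isotropic_iff)
qed

lemma isotropic_vectors_orth_if_maximal_dim:
  assumes "nondegenerate B" "isotropic s B N" "dim (UNIV :: 'v set) \<le> 2 * dim N + 1"
  shows "orth N \<inter> isotropic_vectors = N"
proof
  show "orth N \<inter> isotropic_vectors \<subseteq> N"
  proof (rule ccontr)
    assume "\<not> orth N \<inter> isotropic_vectors \<subseteq> N"
    then obtain x where "x \<in> orth N" "x \<in> isotropic_vectors" "x \<notin> N"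
      by blast
    then have "2 * dim (span (insert x N)) \<le> dim (UNIV :: 'v set)"
      using assms(1,2) by (intro dim_isotropic_le isotropic_span_insert)
    moreover have "dim (span (insert x N)) = Suc (dim N)"
      using assms(2) \<open>x \<notin> N\<close> by (intro dim_span_insert) (simp_all add: isotropic_iff)
    ultimately show False
      using assms(3) by linarith
  qed
  show "N \<subseteq> orth N \<inter> isotropic_vectors"
    using assms(2) isotropic_imp_subset_isotropic_vectors by (simp add: isotropic_iff)
qed

text \<open>
  On a coset \<open>x + N\<close> the form \<open>B y y\<close> is affine, with linear part \<open>2 * B x _\<close>, which is not
  identically zero for \<open>x\<close> outside \<open>orth N\<close>.
\<close>

lemma card_isotropic_vectors_coset:
  assumes sym: "\<And>x y. B x y = B y x" and two: "(2 :: 'k) \<noteq> 0"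
    and N: "isotropic s B N" and "x \<notin> orth N"
  shows "CARD('k) * card {n \<in> N. x + n \<in> isotropic_vectors} = card N"
proof -
  have "subspace N"
    using N by (simp add: isotropic_iff)
  have "x + n \<in> isotropic_vectors \<longleftrightarrow> B x n = - B x x / 2" if "n \<in> N" for n
  proof -
    have "B n n = 0"
      using that N by (simp add: isotropic_def)
    then have affine: "B (x + n) (x + n) = B x x + 2 * B x n"
      by (simp add: form_add_left form_add_right sym[of n x])
    show ?thesis
      unfolding isotropic_vectors_def mem_Collect_eq affine
      using two by (simp add: field_simps add_eq_0_iff)
  qed
  then have "{n \<in> N. x + n \<in> isotropic_vectors} = {n \<in> N. B x n = - B x x / 2}"
    by auto
  moreover obtain a where "a \<in> N" "B x a \<noteq> 0"
    using \<open>x \<notin> orth N\<close> by (auto simp: orth_def dest: reflexive)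
  ultimately show ?thesis
    using card_functional_level_set[OF linear_form \<open>subspace N\<close> \<open>a \<in> N\<close> \<open>B x a \<noteq> 0\<close>]
    by (simp only:)
qed

lemma card_isotropic_vectors_outside_orth:
  assumes "\<And>x y. B x y = B y x" "(2 :: 'k) \<noteq> 0"
    and N: "isotropic s B N" and T: "subspace T" "N \<subseteq> T"
  shows "CARD('k) * card ((T - orth N) \<inter> isotropic_vectors) = card (T - orth N)"
proof (rule card_eq_if_uniform_on_translates[OF finite finite])
  show "N \<noteq> {}"
    using N subspace_0[of N] by (auto simp: isotropic_iff)
  show "CARD('k) * card {n \<in> N. x + n \<in> isotropic_vectors} = card N" if "x \<in> T - orth N" for x
    using that by (intro card_isotropic_vectors_coset assms) simp
  show "x + n \<in> T - orth N" if "x \<in> T - orth N" "n \<in> N" for x n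
  proof -
    have "n \<in> orth N"
      using N that(2) by (auto simp: isotropic_iff)
    then have "x + n \<notin> orth N"
      using that(1) subspace_diff[OF subspace_orth, of "x + n" N n] by auto
    moreover have "x + n \<in> T"
      using T that by (intro subspace_add) auto
    ultimately show ?thesis
      by simp
  qed
qed

lemma card_isotropic_vectors_orth_symmetric:
  assumes "nondegenerate B" "\<And>x y. B x y = B y x" "(2 :: 'k) \<noteq> 0"
    and M: "isotropic s B M" "dim (UNIV :: 'v set) = 2 * dim M + 1"
    and U: "isotropic s B U"
  shows "CARD('k) * card (orth U \<inter> isotropic_vectors) = card (orth U)"
proof -
  have "orth M \<inter> isotropic_vectors = M"
    using assms by (intro isotropic_vectors_orth_if_maximal_dim) simp_all
  then obtain N where N: "isotropic s B N" "U \<subseteq> N" "dim N = dim M"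
    using isotropic_subset_isotropic_of_dim[OF M(1) _ U] by blast
  then have "subspace N" "N \<subseteq> orth N" "orth N \<subseteq> orth U"
    by (simp_all add: isotropic_iff orth_antimono)
  have "dim (orth N) = Suc (dim N)"
    using dim_orth[OF assms(1) \<open>subspace N\<close>] M(2) N(3) by simp
  moreover have "orth N \<inter> isotropic_vectors = N"
    using assms(1) M(2) N by (intro isotropic_vectors_orth_if_maximal_dim) simp_all
  ultimately have "CARD('k) * card (orth N \<inter> isotropic_vectors) = card (orth N)"
    using \<open>subspace N\<close> by (simp add: card_subspace subspace_orth)
  moreover have "CARD('k) * card ((orth U - orth N) \<inter> isotropic_vectors) = card (orth U - orth N)"
    using assms(2,3) N(1) subspace_orth \<open>N \<subseteq> orth N\<close> \<open>orth N \<subseteq> orth U\<close>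
    by (intro card_isotropic_vectors_outside_orth) auto
  moreover have card_orth_Int: "card (orth U \<inter> P) = card (orth N \<inter> P) + card ((orth U - orth N) \<inter> P)"
    for P
    using \<open>orth N \<subseteq> orth U\<close>
    by (subst card_Un_disjoint[symmetric]) (auto intro: arg_cong[where f = card])
  ultimately show ?thesis
    using card_orth_Int[of UNIV] by (simp add: card_orth_Int[of isotropic_vectors] distrib_left)
qed

definition extensions :: "'v set \<Rightarrow> nat \<Rightarrow> 'v set set" where
  "extensions U m = {V. isotropic s B V \<and> U \<subseteq> V \<and> dim V = m}"

lemma extensions_dim:
  assumes "isotropic s B U"
  shows "extensions U (dim U) = {U}"
proof -
  have "U = V" if "V \<in> extensions U (dim U)" for V
    using that assms by (intro subspace_dim_equal) (simp_all add: extensions_def isotropic_iff)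
  then show ?thesis
    using assms by (auto simp: extensions_def)
qed

lemma extensions_span_insert: "extensions (span (insert x U)) m = {V \<in> extensions U m. x \<in> V}"
proof -
  have "span (insert x U) \<subseteq> V \<longleftrightarrow> x \<in> V \<and> U \<subseteq> V" if "isotropic s B V" for V
    using that span_minimal[of "insert x U" V] span_superset[of "insert x U"]
    unfolding isotropic_iff by blast
  then show ?thesis
    by (auto simp: extensions_def)
qed

text \<open>Both sides count the pairs \<open>(x, V)\<close> with \<open>V \<in> extensions U m\<close> and \<open>x \<in> V - U\<close>.\<close>

lemma card_extensions_rec:
  assumes "isotropic s B U"
  shows "card (extensions U m) * (CARD('k) ^ m - CARD('k) ^ dim U) =
    (\<Sum>x\<in>orth U \<inter> isotropic_vectors - U. card (extensions (span (insert x U)) m))"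
proof -
  have card_diff: "card {x \<in> orth U \<inter> isotropic_vectors - U. x \<in> V} =
      CARD('k) ^ m - CARD('k) ^ dim U" if "V \<in> extensions U m" for V
  proof -
    have V: "isotropic s B V" "U \<subseteq> V" "dim V = m"
      using that by (auto simp: extensions_def)
    then have "V \<subseteq> orth V" "orth V \<subseteq> orth U" "V \<subseteq> isotropic_vectors"
      using isotropic_imp_subset_isotropic_vectors by (simp_all add: isotropic_iff orth_antimono)
    then have "{x \<in> orth U \<inter> isotropic_vectors - U. x \<in> V} = V - U"
      by auto
    then show ?thesis
      using V assms by (simp add: isotropic_iff card_Diff_subset card_subspace)
  qed
  have "(\<Sum>x\<in>orth U \<inter> isotropic_vectors - U. card {V \<in> extensions U m. x \<in> V}) =
      (\<Sum>V\<in>extensions U m. CARD('k) ^ m - CARD('k) ^ dim U)"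
    using card_diff by (intro sum_multicount_gen) auto
  then show ?thesis
    by (simp add: extensions_span_insert)
qed

end

section \<open>Weighted flags\<close>

definition flag_type ::
    "('k::field \<Rightarrow> 'v::ab_group_add \<Rightarrow> 'v) \<Rightarrow> ('v set \<times> nat) list \<Rightarrow> (nat \<times> nat) list" where
  "flag_type s F = map (\<lambda>(V, w). (vector_space.dim s V, w)) F"

lemma flag_weight_conv_flag_type: "flag_weight s F = (\<Sum>(m, w)\<leftarrow>flag_type s F. w * m)"
  by (simp add: flag_weight_def flag_type_def case_prod_unfold comp_def)

lemma finite_weighted_flags_of_type:
  fixes s :: "'k::field \<Rightarrow> 'v::{ab_group_add, finite} \<Rightarrow> 'v"
  assumes "vector_space s"
  shows "finite {F \<in> weighted_flags s B. flag_type s F = T}"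
  by (rule finite_subset[OF _ finite_weighted_flags_weight[OF assms, of B "\<Sum>(m, w)\<leftarrow>T. w * m"]])
     (auto simp: flag_weight_conv_flag_type)

lemma weighted_flag_series_eq_if_card_flag_types_eq:
  fixes s :: "'k::field \<Rightarrow> 'v::{ab_group_add, finite} \<Rightarrow> 'v"
    and s' :: "'l::field \<Rightarrow> 'w::{ab_group_add, finite} \<Rightarrow> 'w"
  assumes "vector_space s" "vector_space s'"
    and card_eq: "\<And>T. card {F \<in> weighted_flags s B. flag_type s F = T} =
      card {F \<in> weighted_flags s' B'. flag_type s' F = T}"
  shows "weighted_flag_series s B = weighted_flag_series s' B'"
proof -
  obtain h where h: "bij_betw h (weighted_flags s B) (weighted_flags s' B')"
    "\<And>F. F \<in> weighted_flags s B \<Longrightarrow> flag_type s' (h F) = flag_type s F"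
    using bij_betw_if_card_fibres_eq[OF finite_weighted_flags_of_type[OF assms(1)]
        finite_weighted_flags_of_type[OF assms(2)] card_eq] by metis
  have "weighted_flag_series s B =
      (\<Sum>\<^sub>\<infinity>F\<in>weighted_flags s B. fps_X ^ flag_weight s' (h F))"
    unfolding weighted_flag_series_def
    by (rule infsum_cong) (simp add: flag_weight_conv_flag_type h(2))
  also have "\<dots> = weighted_flag_series s' B'"
    unfolding weighted_flag_series_def by (rule infsum_reindex_bij_betw[OF h(1)])
  finally show ?thesis .
qed

context finite_reflexive_space
begin

definition flags_above :: "'v set \<Rightarrow> (nat \<times> nat) list \<Rightarrow> ('v set \<times> nat) list set" where
  "flags_above U T = {F \<in> weighted_flags s B. (\<forall>(V, w)\<in>set F. U \<subset> V) \<and> flag_type s F = T}"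

lemma flags_above_zero: "flags_above {0} T = {F \<in> weighted_flags s B. flag_type s F = T}"
proof -
  have "{0} \<subset> V" if "isotropic s B V" "V \<noteq> {0}" for V
    using that subspace_0[of V] by (auto simp: isotropic_def)
  then show ?thesis
    by (fastforce simp: flags_above_def weighted_flags_def)
qed

lemma flags_above_Nil: "flags_above U [] = {[]}"
  by (auto simp: flags_above_def flag_type_def weighted_flags_def)

lemma Cons_mem_flags_above_iff:
  assumes "isotropic s B U"
  shows "(V, w) # F \<in> flags_above U ((m, w') # T) \<longleftrightarrow>
     w = w' \<and> 0 < w \<and> dim U < m \<and> V \<in> extensions U m \<and> F \<in> flags_above V T"
proof -
  have "U \<subset> V \<longleftrightarrow> U \<subseteq> V \<and> dim U < dim V" if "isotropic s B V"
    using that assms dim_psubset[of U V] by (auto simp: isotropic_iff span_eq_iff[THEN iffD2])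
  moreover have "V \<noteq> {0}" if "dim U < dim V"
    using that by auto
  moreover have "\<forall>X\<in>fst ` set F. U \<subset> X" if "U \<subset> V" "\<forall>X\<in>fst ` set F. V \<subset> X"
    using that by blast
  ultimately show ?thesis
    by (auto simp: flags_above_def weighted_flags_def flag_type_def extensions_def case_prod_unfold)
qed

lemma flags_above_Cons:
  assumes "isotropic s B U"
  shows "flags_above U ((m, w) # T) =
    (if dim U < m \<and> 0 < w then \<Union>V\<in>extensions U m. (#) (V, w) ` flags_above V T else {})"
proof (rule Set.set_eqI)
  fix F
  show "F \<in> flags_above U ((m, w) # T) \<longleftrightarrow> F \<in> (if dim U < m \<and> 0 < w
      then \<Union>V\<in>extensions U m. (#) (V, w) ` flags_above V T else {})"
  proof (cases F)
    case Nil
    then show ?thesis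
      by (auto simp: flags_above_def flag_type_def)
  next
    case (Cons a F')
    then show ?thesis
      using Cons_mem_flags_above_iff[OF assms] by (cases a) auto
  qed
qed

lemma finite_flags_above: "finite (flags_above U T)"
  by (rule finite_subset[OF _ finite_weighted_flags_of_type[OF vector_space_axioms, of B T]])
     (auto simp: flags_above_def)

end

text \<open>
  A factor with \<open>2 * i > e\<close> is \<open>0\<close> by truncated subtraction. This is the right value: then there is
  no isotropic subspace of dimension \<open>i\<close> to be extended.
\<close>

definition extension_count :: "nat \<Rightarrow> nat \<Rightarrow> nat \<Rightarrow> nat \<Rightarrow> nat" where
  "extension_count q e k m =
     (\<Prod>i\<in>{k..<m}. q ^ (e - i) - q ^ i) div (\<Prod>i\<in>{k..<m}. q ^ m - q ^ i)"

fun flag_count :: "nat \<Rightarrow> nat \<Rightarrow> nat \<Rightarrow> (nat \<times> nat) list \<Rightarrow> nat" where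
  "flag_count q e k [] = 1"
| "flag_count q e k ((m, w) # T) =
     (if k < m \<and> 0 < w then extension_count q e k m * flag_count q e m T else 0)"

locale uniform_isotropic_space = finite_reflexive_space s B
  for s :: "'k::{field, finite} \<Rightarrow> 'v::{ab_group_add, finite} \<Rightarrow> 'v" and B +
  fixes e :: nat
  assumes card_isotropic_vectors_orth:
    "isotropic s B U \<Longrightarrow> card (orth U \<inter> isotropic_vectors) * card U = CARD('k) ^ e"
begin

lemma card_isotropic_vectors_orth_diff:
  assumes "isotropic s B U"
  shows "card (orth U \<inter> isotropic_vectors - U) = CARD('k) ^ (e - dim U) - CARD('k) ^ dim U"
proof -
  have sub: "subspace U" "U \<subseteq> orth U \<inter> isotropic_vectors"
    using assms isotropic_imp_subset_isotropic_vectors by (auto simp: isotropic_iff)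
  have "orth U \<inter> isotropic_vectors \<noteq> {}"
    using sub subspace_0 by blast
  have count: "card (orth U \<inter> isotropic_vectors) * CARD('k) ^ dim U = CARD('k) ^ e"
    using card_isotropic_vectors_orth[OF assms] sub(1) by (simp add: card_subspace)
  have "0 < card (orth U \<inter> isotropic_vectors)"
    using \<open>orth U \<inter> isotropic_vectors \<noteq> {}\<close> by (simp add: card_gt_0_iff)
  then have "CARD('k) ^ dim U \<le> CARD('k) ^ e"
    unfolding count[symmetric] by simp
  then have "dim U \<le> e"
    using one_less_CARD[where 'a = 'k] by simp
  then have "card (orth U \<inter> isotropic_vectors) = CARD('k) ^ (e - dim U)"
    using count by (simp add: power_diff flip: count)
  with sub show ?thesis
    by (simp add: card_Diff_subset card_subspace)
qed

lemma card_extensions_mult: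
  assumes "isotropic s B U" "dim U \<le> m"
  shows "card (extensions U m) * (\<Prod>i\<in>{dim U..<m}. CARD('k) ^ m - CARD('k) ^ i) =
    (\<Prod>i\<in>{dim U..<m}. CARD('k) ^ (e - i) - CARD('k) ^ i)"
  using assms
proof (induction "m - dim U" arbitrary: U)
  case 0
  then have "m = dim U"
    by simp
  with 0 show ?case
    by (simp add: extensions_dim)
next
  case (Suc j)
  let ?k = "dim U"
  let ?E = "orth U \<inter> isotropic_vectors - U"
  let ?den = "\<lambda>k. \<Prod>i\<in>{k..<m}. CARD('k) ^ m - CARD('k) ^ i"
  let ?num = "\<lambda>k. \<Prod>i\<in>{k..<m}. CARD('k) ^ (e - i) - CARD('k) ^ i"
  have "?k < m"
    using Suc.hyps(2) by simp
  have IH: "card (extensions (span (insert x U)) m) * ?den (Suc ?k) = ?num (Suc ?k)"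
    if "x \<in> ?E" for x
  proof -
    have dim_eq: "dim (span (insert x U)) = Suc ?k"
      using that Suc.prems(1) by (intro dim_span_insert) (auto simp: isotropic_iff)
    have "isotropic s B (span (insert x U))"
      using that Suc.prems(1) by (intro isotropic_span_insert) auto
    from Suc.hyps(1)[OF _ this] show ?thesis
      unfolding dim_eq using Suc.hyps(2) by simp
  qed
  have "card (extensions U m) * ?den ?k =
      card (extensions U m) * (CARD('k) ^ m - CARD('k) ^ ?k) * ?den (Suc ?k)"
    using \<open>?k < m\<close> by (simp add: prod.atLeast_Suc_lessThan)
  also have "\<dots> = (\<Sum>x\<in>?E. card (extensions (span (insert x U)) m) * ?den (Suc ?k))"
    by (simp add: card_extensions_rec[OF Suc.prems(1)] sum_distrib_right)
  also have "\<dots> = card ?E * ?num (Suc ?k)"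
    by (simp add: IH)
  also have "\<dots> = ?num ?k"
    using \<open>?k < m\<close> Suc.prems(1)
    by (simp add: card_isotropic_vectors_orth_diff prod.atLeast_Suc_lessThan)
  finally show ?case .
qed

lemma card_extensions:
  assumes "isotropic s B U" "dim U \<le> m"
  shows "card (extensions U m) = extension_count CARD('k) e (dim U) m"
proof -
  have "0 < (\<Prod>i\<in>{dim U..<m}. CARD('k) ^ m - CARD('k) ^ i)"
    using one_less_CARD[where 'a = 'k] by (intro prod_pos) (simp add: power_strict_increasing)
  then show ?thesis
    unfolding extension_count_def card_extensions_mult[OF assms, symmetric] by simp
qed

lemma card_flags_above:
  assumes "isotropic s B U"
  shows "card (flags_above U T) = flag_count CARD('k) e (dim U) T"
  using assms
proof (induction T arbitrary: U)
  case Nil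
  show ?case
    by (simp add: flags_above_Nil)
next
  case (Cons mw T)
  obtain m w where mw: "mw = (m, w)"
    by (cases mw)
  have "card (\<Union>V\<in>extensions U m. (#) (V, w) ` flags_above V T) =
      (\<Sum>V\<in>extensions U m. card ((#) (V, w) ` flags_above V T))"
    by (rule card_UN_disjoint) (auto simp: finite_flags_above)
  also have "\<dots> = (\<Sum>V\<in>extensions U m. flag_count CARD('k) e m T)"
    by (rule sum.cong) (auto simp: card_image extensions_def Cons.IH)
  finally show ?case
    using Cons.prems by (simp add: mw flags_above_Cons card_extensions)
qed

lemma card_weighted_flags_of_type:
  "card {F \<in> weighted_flags s B. flag_type s F = T} = flag_count CARD('k) e 0 T"
  using card_flags_above[OF isotropic_zero] by (simp add: flags_above_zero)

end

section \<open>Symplectic spaces and split quadratic spaces of odd dimension\<close>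

locale finite_symplectic_space = finite_vector_space s
  for s :: "'k::{field, finite} \<Rightarrow> 'v::{ab_group_add, finite} \<Rightarrow> 'v" +
  fixes \<omega> :: "'v \<Rightarrow> 'v \<Rightarrow> 'k"
  assumes symplectic: "symplectic_form s \<omega>"
begin

sublocale finite_reflexive_space s \<omega>
proof
  show bilinear: "bilinear_form s \<omega>"
    using symplectic by (simp add: symplectic_form_def)
  fix x y assume "\<omega> x y = 0"
  moreover have "\<omega> (x + y) (x + y) = \<omega> x x + \<omega> x y + (\<omega> y x + \<omega> y y)"
    using bilinear by (simp add: bilinear_form_def Vector_Spaces.linear_iff)
  ultimately show "\<omega> y x = 0"
    using symplectic by (simp add: symplectic_form_def)
qed

sublocale uniform_isotropic_space s \<omega> "dim UNIV"
proof
  fix U assume "isotropic s \<omega> U"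
  then have "subspace U"
    by (simp add: isotropic_iff)
  have "isotropic_vectors = UNIV"
    using symplectic by (simp add: isotropic_vectors_def symplectic_form_def)
  moreover have "dim (orth U) + dim U = dim UNIV"
    using symplectic \<open>subspace U\<close> by (intro dim_orth) (simp_all add: symplectic_form_def)
  ultimately show "card (orth U \<inter> isotropic_vectors) * card U = CARD('k) ^ dim UNIV"
    using \<open>subspace U\<close> by (simp add: card_subspace subspace_orth flip: power_add)
qed

end

locale finite_split_odd_quadratic_space = finite_vector_space s
  for s :: "'k::{field, finite} \<Rightarrow> 'v::{ab_group_add, finite} \<Rightarrow> 'v" +
  fixes Q :: "'v \<Rightarrow> 'k" and d :: nat
  assumes odd_CARD: "odd CARD('k)"
    and quadratic: "quadratic_form s Q"
    and nondegenerate: "nondegenerate (polar Q)"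
    and dim_UNIV_eq: "dim (UNIV :: 'v set) = 2 * d + 1"
    and ex_isotropic_dim: "\<exists>M. isotropic s (polar Q) M \<and> dim M = d"
begin

lemma polar_commute: "polar Q x y = polar Q y x"
  by (simp add: polar_def add.commute)

sublocale finite_reflexive_space s "polar Q"
  by unfold_locales (use quadratic polar_commute in \<open>auto simp: quadratic_form_def\<close>)

sublocale uniform_isotropic_space s "polar Q" "2 * d"
proof
  fix U assume U: "isotropic s (polar Q) U"
  obtain M where "isotropic s (polar Q) M" "dim M = d"
    using ex_isotropic_dim by blast
  then have "CARD('k) * card (orth U \<inter> isotropic_vectors) = card (orth U)"
    using nondegenerate polar_commute two_neq_zero_if_odd_CARD[OF odd_CARD] dim_UNIV_eq U
    by (intro card_isotropic_vectors_orth_symmetric[where M = M]) simp_all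
  moreover have "dim (orth U) + dim U = 2 * d + 1"
    using dim_orth[OF nondegenerate] U dim_UNIV_eq by (simp add: isotropic_iff)
  then have "card (orth U) * card U = CARD('k) * CARD('k) ^ (2 * d)"
    using U by (simp add: isotropic_iff card_subspace subspace_orth flip: power_add power_Suc)
  ultimately have "CARD('k) * (card (orth U \<inter> isotropic_vectors) * card U) =
      CARD('k) * CARD('k) ^ (2 * d)"
    by (metis mult.assoc)
  then show "card (orth U \<inter> isotropic_vectors) * card U = CARD('k) ^ (2 * d)"
    by simp
qed

end

theorem theorem3p3:
  fixes q d :: nat
    and scaleV :: "'k::{field, finite} \<Rightarrow> 'v::{ab_group_add, finite} \<Rightarrow> 'v"
    and scaleW :: "'k \<Rightarrow> 'w::{ab_group_add, finite} \<Rightarrow> 'w"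
    and \<omega> :: "'v \<Rightarrow> 'v \<Rightarrow> 'k"
    and Q :: "'w \<Rightarrow> 'k"
  assumes "primepow q" and "odd q" and "CARD('k) = q"
    and "vector_space scaleV" and "vector_space.dim scaleV (UNIV :: 'v set) = 2 * d"
    and "symplectic_form scaleV \<omega>"
    and "vector_space scaleW" and "vector_space.dim scaleW (UNIV :: 'w set) = 2 * d + 1"
    and "quadratic_form scaleW Q" and "nondegenerate (polar Q)"
    and "\<exists>U. isotropic scaleW (polar Q) U \<and> vector_space.dim scaleW U = d"
  shows "weighted_flag_series scaleV \<omega> = weighted_flag_series scaleW (polar Q)"
proof (rule weighted_flag_series_eq_if_card_flag_types_eq)
  show "vector_space scaleV" "vector_space scaleW"
    by fact+
  interpret V: finite_symplectic_space scaleV \<omega>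
    using assms by (simp add: finite_symplectic_space_def finite_vector_space_def
        finite_symplectic_space_axioms_def)
  interpret W: finite_split_odd_quadratic_space scaleW Q d
    using assms by (simp add: finite_split_odd_quadratic_space_def finite_vector_space_def
        finite_split_odd_quadratic_space_axioms_def)
  show "card {F \<in> weighted_flags scaleV \<omega>. flag_type scaleV F = T} =
      card {F \<in> weighted_flags scaleW (polar Q). flag_type scaleW F = T}" for T
    using V.card_weighted_flags_of_type W.card_weighted_flags_of_type assms(5) by simp
qed

end
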